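(* Let $(\mathfrak g,J)$ be a real Lie algebra with a complex structure $J$ admitting a vector space decomposition $\mathfrak g=\mathfrak g_0\oplus\mathfrak g_1$ with $\mathfrak g_k$ a $J$-stable subspace, $k=0,1$. Let $\mathfrak v$ be a real vector space with a real endomorphism $I$ satisfying $I^2=-\mathrm{id}$, and let $\rho:\mathfrak g\to\mathfrak{gl}(\mathfrak v)$ be a (real) Lie algebra representation satisfying: (i) $\rho(x)I=I\rho(x)$ for all $x\in\mathfrak g_0$; (ii) $\rho(Jx)Iv=\rho(x)v$ for all $x\in\mathfrak g_1$, $v\in\mathfrak v$. Then the endomorphism $J_+(x,v)=(Jx,Iv)$ is integrable on $\mathfrak g\oplus_\rho\mathfrak v$. If $\mathfrak g_1=0$, then $J_-(x,v)=(Jx,-Iv)$ is also integrable on $\mathfrak g\oplus_\rho\mathfrak v$.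
   Context: All Lie algebras and vector spaces are finite-dimensional over $\mathbb R$. A complex structure on a real Lie algebra $\mathfrak g$ is an endomorphism $J$ with $J^2=-1$ which is integrable, i.e. $N_J(x,y)=J[x,y]-[Jx,y]-[x,Jy]-J[Jx,Jy]=0$ for all $x,y$. The semidirect product $\mathfrak g\oplus_\rho\mathfrak v$ ($\mathfrak v$ viewed as an abelian Lie algebra) has bracket $[(x,u),(y,v)]=([x,y],\rho(x)v-\rho(y)u)$. *)

theory Defs
  imports "HOL-Analysis.Analysis"
begin

(* The class euclidean_space is avoided because it excludes the zero space and
   fixes an inner product. *)
definition finite_dim :: "'a::real_vector itself \<Rightarrow> bool" where
  "finite_dim _ \<longleftrightarrow> (\<exists>B :: 'a set. finite B \<and> span B = UNIV)"

locale real_lie_algebra =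
  fixes bracket :: "'g::real_vector \<Rightarrow> 'g \<Rightarrow> 'g"
  assumes finite_dim: "finite_dim TYPE('g)"
    and bilinear: "bilinear bracket"
    and alternating: "bracket x x = 0"
    and jacobi: "bracket x (bracket y z) + bracket y (bracket z x) + bracket z (bracket x y) = 0"

definition nijenhuis ::
    "('g::real_vector \<Rightarrow> 'g \<Rightarrow> 'g) \<Rightarrow> ('g \<Rightarrow> 'g) \<Rightarrow> 'g \<Rightarrow> 'g \<Rightarrow> 'g" where
  "nijenhuis br J x y = J (br x y) - br (J x) y - br x (J y) - J (br (J x) (J y))"

definition integrable_endo :: "('g::real_vector \<Rightarrow> 'g \<Rightarrow> 'g) \<Rightarrow> ('g \<Rightarrow> 'g) \<Rightarrow> bool" where
  "integrable_endo br J \<longleftrightarrow> (\<forall>x y. nijenhuis br J x y = 0)"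

definition almost_complex :: "('v::real_vector \<Rightarrow> 'v) \<Rightarrow> bool" where
  "almost_complex I \<longleftrightarrow> linear I \<and> (\<forall>v. I (I v) = - v)"

definition complex_structure :: "('g::real_vector \<Rightarrow> 'g \<Rightarrow> 'g) \<Rightarrow> ('g \<Rightarrow> 'g) \<Rightarrow> bool" where
  "complex_structure br J \<longleftrightarrow> almost_complex J \<and> integrable_endo br J"

(* Bilinearity says that each rho x is a linear endomorphism and that rho itself is linear. *)
definition lie_representation ::
    "('g::real_vector \<Rightarrow> 'g \<Rightarrow> 'g) \<Rightarrow> ('g \<Rightarrow> 'v::real_vector \<Rightarrow> 'v) \<Rightarrow> bool" where
  "lie_representation br \<rho> \<longleftrightarrow>
     bilinear \<rho> \<and> (\<forall>x y v. \<rho> (br x y) v = \<rho> x (\<rho> y v) - \<rho> y (\<rho> x v))"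

definition direct_decomposition :: "'g::real_vector set \<Rightarrow> 'g set \<Rightarrow> bool" where
  "direct_decomposition U W \<longleftrightarrow>
     subspace U \<and> subspace W \<and> U \<inter> W = {0} \<and> {u + w |u w. u \<in> U \<and> w \<in> W} = UNIV"

definition semidirect_bracket ::
    "('g::real_vector \<Rightarrow> 'g \<Rightarrow> 'g) \<Rightarrow> ('g \<Rightarrow> 'v::real_vector \<Rightarrow> 'v) \<Rightarrow>
     'g \<times> 'v \<Rightarrow> 'g \<times> 'v \<Rightarrow> 'g \<times> 'v" where
  "semidirect_bracket br \<rho> = (\<lambda>(x, u) (y, v). (br x y, \<rho> x v - \<rho> y u))"

lemma finite_dim_prod:
  assumes "finite_dim TYPE('a::real_vector)" "finite_dim TYPE('b::real_vector)"
  shows "finite_dim TYPE('a \<times> 'b)"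
proof -
  obtain B :: "'a set" and C :: "'b set"
    where B: "finite B" "span B = UNIV" and C: "finite C" "span C = UNIV"
    using assms unfolding finite_dim_def by blast
  let ?f = "\<lambda>x::'a. (x, 0::'b)" and ?g = "\<lambda>y::'b. (0::'a, y)"
  let ?S = "?f ` B \<union> ?g ` C"
  have "linear ?f" "linear ?g" by (auto intro!: linearI)
  then have sp: "span (?f ` B) = range ?f" "span (?g ` C) = range ?g"
    using B C by (simp_all add: linear_span_image)
  have "(x, y) \<in> span ?S" for x y
  proof -
    have "?f x \<in> span ?S" using sp(1) span_mono[of "?f ` B" ?S] by blast
    moreover have "?g y \<in> span ?S" using sp(2) span_mono[of "?g ` C" ?S] by blast
    ultimately have "?f x + ?g y \<in> span ?S" by (rule span_add)
    then show ?thesis by simp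
  qed
  then have "span ?S = UNIV" by auto
  moreover have "finite ?S" using B C by simp
  ultimately show ?thesis unfolding finite_dim_def by blast
qed

lemma real_lie_algebra_semidirect:
  fixes br :: "'g::real_vector \<Rightarrow> 'g \<Rightarrow> 'g" and \<rho> :: "'g \<Rightarrow> 'v::real_vector \<Rightarrow> 'v"
  assumes "real_lie_algebra br" "finite_dim TYPE('v)" "lie_representation br \<rho>"
  shows "real_lie_algebra (semidirect_bracket br \<rho>)"
proof -
  interpret real_lie_algebra br by fact
  have bil: "bilinear \<rho>"
    and rep: "\<And>x y v. \<rho> (br x y) v = \<rho> x (\<rho> y v) - \<rho> y (\<rho> x v)"
    using assms(3) unfolding lie_representation_def by auto
  show ?thesis
  proof
    show "finite_dim TYPE('g \<times> 'v)"
      using finite_dim assms(2) by (rule finite_dim_prod)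
    show "bilinear (semidirect_bracket br \<rho>)"
      unfolding bilinear_def
      by (auto intro!: linearI simp: semidirect_bracket_def algebra_simps
            bilinear_ladd[OF bil] bilinear_radd[OF bil] bilinear_lmul[OF bil] bilinear_rmul[OF bil]
            bilinear_ladd[OF bilinear] bilinear_radd[OF bilinear]
            bilinear_lmul[OF bilinear] bilinear_rmul[OF bilinear])
    fix x y z :: "'g \<times> 'v"
    show "semidirect_bracket br \<rho> x x = 0"
      by (cases x) (simp add: semidirect_bracket_def alternating zero_prod_def)
    show "semidirect_bracket br \<rho> x (semidirect_bracket br \<rho> y z) +
        semidirect_bracket br \<rho> y (semidirect_bracket br \<rho> z x) +
        semidirect_bracket br \<rho> z (semidirect_bracket br \<rho> x y) = 0"
      by (cases x; cases y; cases z)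
         (simp add: semidirect_bracket_def jacobi zero_prod_def rep bilinear_rsub[OF bil])
  qed
qed

lemma almost_complex_uminus:
  "almost_complex I \<Longrightarrow> almost_complex (\<lambda>v. - I v)"
  unfolding almost_complex_def by (auto intro: linear_compose_neg simp: linear_neg)

lemma almost_complex_map_prod:
  assumes "almost_complex J" "almost_complex I"
  shows "almost_complex (map_prod J I)"
  using assms unfolding almost_complex_def
  by (auto intro!: linearI simp: linear_add linear_scale)

end

theory Submission
  imports Defs
begin

text \<open>
  The Lie algebra component of the Nijenhuis tensor of \<open>J \<times> I\<close> is the tensor of \<open>J\<close>, hence zero.
  The semidirect bracket vanishes on pairs from the representation space, so the other component of
  the tensor at \<open>(x, u)\<close> and \<open>(y, v)\<close> splits as \<open>A x v - A y u\<close>, where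
  \<open>A x v = I (\<rho> x v) - \<rho> (J x) v - \<rho> x (I v) - I (\<rho> (J x) (I v))\<close>. Integrability thus reduces to
  \<open>A = 0\<close> (\<open>integrable_endo_semidirect\<close>). This condition is linear in \<open>x\<close>, so it may be checked on
  the two summands, where the four terms cancel in pairs, but in different pairs
  (\<open>mixed_term_commuting\<close>, \<open>mixed_term_twisted\<close>). Replacing \<open>I\<close> by \<open>- I\<close> preserves the commutation
  condition on \<open>g\<^sub>0\<close> but introduces a sign into the condition on \<open>g\<^sub>1\<close>; this is why the claim about
  \<open>J \<times> (- I)\<close> requires \<open>g\<^sub>1\<close> to be trivial.
\<close>

text \<open>
  For bilinear \<open>\<rho>\<close>, the third hypothesis says that the representation component of the Nijenhuis tensor vanishes on
  mixed pairs \<open>(x, 0), (0, v)\<close>. That component changes sign when its arguments are swapped, so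
  pairs in the other order need no hypothesis of their own.
\<close>
lemma integrable_endo_semidirect:
  assumes J: "integrable_endo br J" and I: "linear I"
    and A: "\<And>x v. I (\<rho> x v) - \<rho> (J x) v - \<rho> x (I v) - I (\<rho> (J x) (I v)) = 0"
  shows "integrable_endo (semidirect_bracket br \<rho>) (\<lambda>(x, v). (J x, I v))"
proof -
  let ?N = "nijenhuis (semidirect_bracket br \<rho>) (\<lambda>(x, v). (J x, I v))"
  have "?N (x, u) (y, v) = 0" for x u y v
  proof -
    have "?N (x, u) (y, v) =
      (nijenhuis br J x y,
       (I (\<rho> x v) - \<rho> (J x) v - \<rho> x (I v) - I (\<rho> (J x) (I v))) -
       (I (\<rho> y u) - \<rho> (J y) u - \<rho> y (I u) - I (\<rho> (J y) (I u))))"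
      by (simp add: nijenhuis_def semidirect_bracket_def linear_diff[OF I])
    also have "\<dots> = 0"
      using J by (simp only: A integrable_endo_def) (simp add: zero_prod_def)
    finally show ?thesis .
  qed
  then show ?thesis by (auto simp: integrable_endo_def)
qed

text \<open>Since \<open>\<rho> x\<close> and \<open>\<rho> (J x)\<close> both commute with \<open>I\<close>, the first term cancels the third, and
  \<open>I\<^sup>2 = - 1\<close> makes the second cancel the fourth.\<close>
lemma mixed_term_commuting:
  assumes "almost_complex I"
    and "\<And>v. \<rho> x (I v) = I (\<rho> x v)" "\<And>v. \<rho> (J x) (I v) = I (\<rho> (J x) v)"
  shows "I (\<rho> x v) - \<rho> (J x) v - \<rho> x (I v) - I (\<rho> (J x) (I v)) = 0"
  using assms by (simp add: almost_complex_def)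

text \<open>Here the first term cancels the fourth, and the hypothesis at \<open>I v\<close> makes the second cancel
  the third.\<close>
lemma mixed_term_twisted:
  assumes I: "almost_complex I" and "linear (\<rho> (J x))"
    and tw: "\<And>v. \<rho> (J x) (I v) = \<rho> x v"
  shows "I (\<rho> x v) - \<rho> (J x) v - \<rho> x (I v) - I (\<rho> (J x) (I v)) = 0"
proof -
  have "\<rho> x (I v) = - \<rho> (J x) v"
    using tw[of "I v"] I linear_neg[OF assms(2)] by (simp add: almost_complex_def)
  then show ?thesis by (simp add: tw)
qed

theorem proposition3p3:
  fixes br :: "'g::real_vector \<Rightarrow> 'g \<Rightarrow> 'g"
    and J :: "'g \<Rightarrow> 'g"
    and g\<^sub>0 g\<^sub>1 :: "'g set"
    and I :: "'v::real_vector \<Rightarrow> 'v"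
    and \<rho> :: "'g \<Rightarrow> 'v \<Rightarrow> 'v"
  assumes "real_lie_algebra br"
    and "complex_structure br J"
    and "direct_decomposition g\<^sub>0 g\<^sub>1"
    and "J ` g\<^sub>0 \<subseteq> g\<^sub>0"
    and "J ` g\<^sub>1 \<subseteq> g\<^sub>1"
    and "finite_dim TYPE('v)"
    and "almost_complex I"
    and "lie_representation br \<rho>"
    and "\<forall>x\<in>g\<^sub>0. \<rho> x \<circ> I = I \<circ> \<rho> x"
    and "\<forall>x\<in>g\<^sub>1. \<forall>v. \<rho> (J x) (I v) = \<rho> x v"
  shows "integrable_endo (semidirect_bracket br \<rho>) (\<lambda>(x, v). (J x, I v)) \<and>
    (g\<^sub>1 = {0} \<longrightarrow> integrable_endo (semidirect_bracket br \<rho>) (\<lambda>(x, v). (J x, - I v)))"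
proof -
  have J: "integrable_endo br J" and lJ: "linear J"
    using assms(2) by (auto simp: complex_structure_def almost_complex_def)
  have lI: "linear I" using assms(7) by (simp add: almost_complex_def)
  have bil: "bilinear \<rho>" using assms(8) by (simp add: lie_representation_def)
  have lin: "linear (\<rho> x)" for x using bil by (simp add: bilinear_def)
  have comm: "\<rho> x (I v) = I (\<rho> x v)" if "x \<in> g\<^sub>0" for x v
    using assms(9) that by (auto simp: fun_eq_iff)
  have J0: "J x \<in> g\<^sub>0" if "x \<in> g\<^sub>0" for x using assms(4) that by blast
  have split: "\<exists>a b. a \<in> g\<^sub>0 \<and> b \<in> g\<^sub>1 \<and> x = a + b" for x
    using assms(3) unfolding direct_decomposition_def by blast
  define A where "A x v = I (\<rho> x v) - \<rho> (J x) v - \<rho> x (I v) - I (\<rho> (J x) (I v))" for x v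
  have "A x v = 0" for x v
  proof -
    obtain a b where ab: "a \<in> g\<^sub>0" "b \<in> g\<^sub>1" "x = a + b" using split by blast
    have "A x v = A a v + A b v"
      by (simp add: A_def ab(3) linear_add[OF lJ] linear_add[OF lI] bilinear_ladd[OF bil])
    moreover have "A a v = 0"
      unfolding A_def by (intro mixed_term_commuting assms(7) comm J0 ab(1))
    moreover have "A b v = 0"
      unfolding A_def using assms(10) ab(2) by (intro mixed_term_twisted assms(7) lin) auto
    ultimately show ?thesis by simp
  qed
  then have plus: "integrable_endo (semidirect_bracket br \<rho>) (\<lambda>(x, v). (J x, I v))"
    unfolding A_def by (intro integrable_endo_semidirect J lI)
  have minus: "integrable_endo (semidirect_bracket br \<rho>) (\<lambda>(x, v). (J x, - I v))"
    if "g\<^sub>1 = {0}"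
  proof -
    have g0: "x \<in> g\<^sub>0" for x using split[of x] that by auto
    have mI: "almost_complex (\<lambda>v. - I v)" using assms(7) by (rule almost_complex_uminus)
    have mcomm: "\<rho> x (- I v) = - I (\<rho> x v)" for x v
      by (simp add: linear_neg[OF lin] comm[OF g0])
    show ?thesis
      by (rule integrable_endo_semidirect[OF J])
         (use mI in \<open>simp add: almost_complex_def\<close>,
          rule mixed_term_commuting[where I = "\<lambda>v. - I v" and \<rho> = \<rho>, OF mI mcomm mcomm])
  qed
  show ?thesis using plus minus by blast
qed

end
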